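(* Let $T$ be a Kreiss bounded operator on a complex Hilbert space. Then $\|T^n\|=O\left(\frac{n}{\sqrt{\log n}}\right)$ as $n\to\infty$.
   Context: A bounded linear operator $T$ on a complex Banach space is Kreiss bounded if there exists $C>0$ such that for every $\lambda\in\mathbb{C}$ with $|\lambda|>1$ the operator $\lambda I-T$ is invertible and $\|(\lambda I-T)^{-1}\|\le \frac{C}{|\lambda|-1}$. *)

theory Defs
  imports "HOL-Analysis.Analysis" "HOL-Library.Landau_Symbols"
begin

class scaleC =
  fixes scaleC :: "complex \<Rightarrow> 'a \<Rightarrow> 'a" (infixr "*\<^sub>C" 75)

class complex_vector = scaleC + real_vector +
  assumes scaleC_add_right: "a *\<^sub>C (x + y) = a *\<^sub>C x + a *\<^sub>C y"
    and scaleC_add_left: "(a + b) *\<^sub>C x = a *\<^sub>C x + b *\<^sub>C x"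
    and scaleC_scaleC: "a *\<^sub>C b *\<^sub>C x = (a * b) *\<^sub>C x"
    and scaleC_one: "1 *\<^sub>C x = x"
    and scaleR_scaleC: "r *\<^sub>R x = complex_of_real r *\<^sub>C x"

class complex_normed_vector = complex_vector + real_normed_vector +
  assumes norm_scaleC: "norm (a *\<^sub>C x) = cmod a * norm x"

class complex_banach = complex_normed_vector + banach

text \<open>The inner product is linear in the first argument and conjugate-linear in the second.\<close>

class complex_inner = complex_normed_vector +
  fixes cinner :: "'a \<Rightarrow> 'a \<Rightarrow> complex"
  assumes cinner_commute: "cinner x y = cnj (cinner y x)"
    and cinner_add_left: "cinner (x + y) z = cinner x z + cinner y z"
    and cinner_scaleC_left: "cinner (a *\<^sub>C x) y = a * cinner x y"
    and cinner_self: "cinner x x = complex_of_real ((norm x)\<^sup>2)"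

class complex_hilbert_space = complex_inner + complex_banach

instantiation complex :: complex_hilbert_space
begin

definition "scaleC_complex a (x::complex) = a * x"

definition "cinner_complex x (y::complex) = x * cnj y"

instance
  by standard
    (simp_all only: scaleC_complex_def cinner_complex_def complex_norm_square norm_mult
      scaleR_conv_of_real, simp_all add: algebra_simps)

end

definition bounded_clinear ::
    "('a::complex_normed_vector \<Rightarrow> 'b::complex_normed_vector) \<Rightarrow> bool" where
  "bounded_clinear T \<longleftrightarrow> bounded_linear T \<and> (\<forall>c x. T (c *\<^sub>C x) = c *\<^sub>C T x)"

text \<open>Boundedness of the inverse is stated explicitly: \<^const>\<open>onorm\<close> is meaningful only for bounded
  operators.\<close>

definition kreiss_bounded :: "('a::complex_banach \<Rightarrow> 'a) \<Rightarrow> bool" where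
  "kreiss_bounded T \<longleftrightarrow> bounded_clinear T \<and>
    (\<exists>C>0. \<forall>z. cmod z > 1 \<longrightarrow>
      (let S = (\<lambda>x. z *\<^sub>C x - T x) in
        bij S \<and> bounded_clinear (inv S) \<and> onorm (inv S) \<le> C / (cmod z - 1)))"

end

theory Submission
  imports Defs "HOL-Complex_Analysis.Complex_Analysis"
begin

text \<open>
  Averaging \<open>(I - zT)\<^sup>-\<^sup>1\<close> over the circle of radius \<open>n/(n+1)\<close> gives, by Parseval, the square function
  bound \<open>(\<Sum>k<n. \<parallel>T\<^sup>k x\<parallel>\<^sup>2) \<le> K\<^sup>2 n\<^sup>2 \<parallel>x\<parallel>\<^sup>2\<close> together with its dual
  \<open>\<parallel>\<Sum>j<n. T\<^sup>j z\<^sub>j\<parallel>\<^sup>2 \<le> K\<^sup>2 n\<^sup>2 (\<Sum>j<n. \<parallel>z\<^sub>j\<parallel>\<^sup>2)\<close>. Applied to \<open>z\<^sub>j = T\<^bsup>N-j\<^esup> x\<close> with \<open>j\<close> in a dyadic block,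
  the dual bound shows that each of the about \<open>log N\<close> blocks carries at least a fixed multiple of
  \<open>\<parallel>T\<^sup>N x\<parallel>\<^sup>2\<close> of the square function, whose total is at most \<open>K\<^sup>2 N\<^sup>2 \<parallel>x\<parallel>\<^sup>2\<close>. The averages are taken over
  roots of unity, so that they are finite sums; Cauchy's inequality for the scalar functions
  \<open>\<langle>(I - zT)\<^sup>-\<^sup>1 u, y\<rangle>\<close> shows that \<open>r\<^sup>m \<parallel>T\<^sup>m\<parallel> \<le> 1\<close> for \<open>r < 1\<close> and large \<open>m\<close>, which controls the aliasing.
\<close>

section \<open>Elementary algebra of complex scalars and inner products\<close>

lemma bounded_linear_scaleC_right: "bounded_linear (\<lambda>x::'a::complex_normed_vector. a *\<^sub>C x)"
proof (rule bounded_linear_intro[where K = "cmod a"])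
  fix r :: real and x :: 'a
  show "a *\<^sub>C r *\<^sub>R x = r *\<^sub>R a *\<^sub>C x"
    by (simp add: scaleR_scaleC scaleC_scaleC mult.commute)
qed (simp_all add: scaleC_add_right norm_scaleC mult.commute)

lemmas scaleC_diff_right = linear_diff[OF bounded_linear.linear[OF bounded_linear_scaleC_right]]
lemmas scaleC_zero_right [simp] = linear_0[OF bounded_linear.linear[OF bounded_linear_scaleC_right]]
lemmas scaleC_sum_right = linear_sum[OF bounded_linear.linear[OF bounded_linear_scaleC_right]]

lemma scaleC_diff_left: "(a - b) *\<^sub>C (x::'a::complex_vector) = a *\<^sub>C x - b *\<^sub>C x"
  using scaleC_add_left[of "a - b" b x] by (simp add: algebra_simps)

lemma scaleC_zero_left [simp]: "0 *\<^sub>C (x::'a::complex_vector) = 0"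
  using scaleC_diff_left[of 0 0 x] by simp

lemma scaleC_sum_left: "(\<Sum>i\<in>A. c i) *\<^sub>C (x::'a::complex_vector) = (\<Sum>i\<in>A. c i *\<^sub>C x)"
  by (induction A rule: infinite_finite_induct) (simp_all add: scaleC_add_left)

lemma cinner_diff_left: "cinner (x - y) (z::'a::complex_inner) = cinner x z - cinner y z"
  using cinner_add_left[of "x - y" y z] by (simp add: algebra_simps)

lemma cinner_zero_left [simp]: "cinner 0 (z::'a::complex_inner) = 0"
  using cinner_diff_left[of 0 0 z] by simp

lemma cinner_sum_left: "cinner (\<Sum>i\<in>A. f i) (z::'a::complex_inner) = (\<Sum>i\<in>A. cinner (f i) z)"
  by (induction A rule: infinite_finite_induct) (simp_all add: cinner_add_left)

lemma cinner_scaleC_right: "cinner x (a *\<^sub>C y) = cnj a * cinner x (y::'a::complex_inner)"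
  by (metis cinner_commute cinner_scaleC_left complex_cnj_mult)

lemma cinner_sum_right: "cinner (z::'a::complex_inner) (\<Sum>i\<in>A. f i) = (\<Sum>i\<in>A. cinner z (f i))"
  by (subst cinner_commute, subst cinner_sum_left, simp add: cinner_commute[symmetric])

lemma cinner_diff_right: "cinner z (x - y) = cinner z x - cinner z (y::'a::complex_inner)"
  by (subst cinner_commute, subst cinner_diff_left, simp add: cinner_commute[symmetric])

text \<open>Cauchy-Schwarz: expand the squared norm of \<open>x\<close> minus its orthogonal
  projection onto the line spanned by \<open>y\<close>, and use that it is nonnegative.\<close>

lemma norm_cinner_le: "cmod (cinner x y) \<le> norm x * norm (y::'a::complex_inner)"
proof (cases "y = 0")
  case True
  then show ?thesis by (subst cinner_commute) simp
next
  case False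
  define c where "c = cinner x y / complex_of_real ((norm y)\<^sup>2)"
  have y: "complex_of_real ((norm y)\<^sup>2) \<noteq> 0" using False by simp
  have "complex_of_real ((norm (x - c *\<^sub>C y))\<^sup>2) = cinner (x - c *\<^sub>C y) (x - c *\<^sub>C y)"
    by (simp add: cinner_self)
  also have "\<dots> = cinner x x - cnj c * cinner x y - c * (cinner y x - cnj c * cinner y y)"
    by (simp add: cinner_diff_left cinner_diff_right cinner_scaleC_left cinner_scaleC_right algebra_simps)
  also have "cinner y x = cnj c * cinner y y"
    unfolding c_def cinner_self by (subst cinner_commute) (use y in simp)
  also have "cinner x x - cnj c * cinner x y - c * (cnj c * cinner y y - cnj c * cinner y y)
      = complex_of_real ((norm x)\<^sup>2 - (cmod (cinner x y))\<^sup>2 / (norm y)\<^sup>2)"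
    unfolding c_def cinner_self by (simp add: complex_norm_square[unfolded of_real_power] mult.commute)
  finally have "(norm x)\<^sup>2 - (cmod (cinner x y))\<^sup>2 / (norm y)\<^sup>2 = (norm (x - c *\<^sub>C y))\<^sup>2"
    unfolding of_real_eq_iff by simp
  then have "(cmod (cinner x y))\<^sup>2 / (norm y)\<^sup>2 \<le> (norm x)\<^sup>2"
    by (metis diff_ge_0_iff_ge zero_le_power2)
  then have "(cmod (cinner x y))\<^sup>2 \<le> (norm x * norm y)\<^sup>2"
    using False by (simp add: divide_simps power_mult_distrib)
  then show ?thesis by (rule power2_le_imp_le) simp
qed

lemma bounded_linear_cinner_left: "bounded_linear (\<lambda>x::'a::complex_inner. cinner x y)"
  by (rule bounded_linear_intro[where K = "norm y"])
    (simp_all add: cinner_add_left scaleR_scaleC cinner_scaleC_left norm_cinner_le scaleC_complex_def)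

section \<open>Roots of unity and the discrete Parseval identity\<close>

definition unity_root :: "nat \<Rightarrow> nat \<Rightarrow> complex" where
  "unity_root m l = cis (2 * pi * real l / real m)"

lemma norm_unity_root [simp]: "cmod (unity_root m l) = 1"
  by (simp add: unity_root_def)

text \<open>The summands are the powers of \<open>q\<close>, an \<open>m\<close>-th root of unity,
  so for \<open>j\<close> different from \<open>k\<close> the geometric sum vanishes.\<close>

lemma sum_unity_root:
  assumes "j < m" "k < m"
  shows "(\<Sum>l<m. unity_root m l ^ j * cnj (unity_root m l ^ k)) = (if j = k then of_nat m else 0)"
proof -
  define q where "q = cis (2 * pi * (real j - real k) / real m)"
  have m: "m > 0" using assms by simp
  have term_eq: "unity_root m l ^ j * cnj (unity_root m l ^ k) = q ^ l" for l
  proof -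
    have "unity_root m l ^ j * cnj (unity_root m l ^ k) =
        cis (real j * (2 * pi * real l / real m) + - (real k * (2 * pi * real l / real m)))"
      by (simp only: unity_root_def Complex.DeMoivre cis_cnj cis_mult)
    also have "\<dots> = cis (real l * (2 * pi * (real j - real k) / real m))"
      by (rule arg_cong[where f = cis]) (use m in \<open>simp add: field_simps\<close>)
    finally show ?thesis by (simp only: q_def Complex.DeMoivre)
  qed
  have "q = 1" if "j = k" using that by (simp add: q_def)
  moreover have "(\<Sum>l<m. q ^ l) = 0" if "j \<noteq> k"
  proof -
    \<comment> \<open>\<open>q = 1\<close> would make \<open>m\<close> divide \<open>j - k\<close>,
      which is impossible for distinct indices below \<open>m\<close>.\<close>
    have "q \<noteq> 1"
    proof
      assume "q = 1"
      then have "cos (2 * pi * (real j - real k) / real m) = 1"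
        by (metis q_def cis.simps(1) one_complex.simps(1))
      then obtain i :: int where "2 * pi * (real j - real k) / real m = of_int i * 2 * pi"
        using cos_one_2pi_int by blast
      then have "2 * pi * ((real j - real k) / real m) = 2 * pi * of_int i" by (simp add: mult.commute)
      then have "(real j - real k) / real m = of_int i" by (simp only: mult_cancel_left) simp
      then have "real j - real k = of_int i * real m" using m by (simp add: field_simps)
      then have "real_of_int (int j - int k) = real_of_int (i * int m)" by simp
      then have i: "int j - int k = i * int m" by linarith
      have "\<bar>int j - int k\<bar> < int m" using assms by linarith
      then have "\<bar>i\<bar> * int m < 1 * int m" unfolding i by (simp add: abs_mult)
      then have "i = 0" using m by (simp add: mult_less_cancel_right)
      then show False using i that by simp
    qed
    moreover have "q ^ m = 1"
    proof -
      have "q ^ m = cis (2 * pi * of_int (int j - int k))"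
        using m by (simp add: q_def Complex.DeMoivre)
      then show ?thesis by (simp add: cis_multiple_2pi)
    qed
    ultimately show ?thesis by (simp add: sum_gp_strict)
  qed
  ultimately show ?thesis unfolding term_eq by auto
qed

text \<open>Expand each squared norm as a double sum of inner products and sum over \<open>l\<close>
  first; orthogonality of the characters leaves only the diagonal.\<close>

lemma unity_root_Parseval:
  fixes v :: "nat \<Rightarrow> 'a::complex_inner"
  shows "(\<Sum>l<m. (norm (\<Sum>k<m. unity_root m l ^ k *\<^sub>C v k))\<^sup>2) = real m * (\<Sum>k<m. (norm (v k))\<^sup>2)"
proof -
  let ?w = "unity_root m"
  have "complex_of_real (\<Sum>l<m. (norm (\<Sum>k<m. ?w l ^ k *\<^sub>C v k))\<^sup>2)
     = (\<Sum>l<m. \<Sum>j<m. \<Sum>k<m. (?w l ^ j * cnj (?w l ^ k)) * cinner (v j) (v k))"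
    unfolding of_real_sum cinner_self[symmetric] cinner_sum_left
    unfolding cinner_sum_right cinner_scaleC_left cinner_scaleC_right
    by (simp add: sum_distrib_left mult_ac)
  also have "\<dots> = (\<Sum>j<m. \<Sum>k<m. \<Sum>l<m. (?w l ^ j * cnj (?w l ^ k)) * cinner (v j) (v k))"
    by (subst sum.swap, rule sum.cong[OF refl], rule sum.swap)
  also have "\<dots> = (\<Sum>j<m. \<Sum>k<m. (if j = k then of_nat m else 0) * cinner (v j) (v k))"
    by (simp only: sum_distrib_right[symmetric])
      (intro sum.cong refl arg_cong2[where f = "(*)"] sum_unity_root, auto)
  also have "\<dots> = (\<Sum>j<m. of_nat m * cinner (v j) (v j))"
    by (intro sum.cong refl) (simp add: if_distrib[of "\<lambda>c. c * _"] cong: if_cong)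
  also have "\<dots> = complex_of_real (real m * (\<Sum>k<m. (norm (v k))\<^sup>2))"
    by (simp add: cinner_self sum_distrib_left)
  finally show ?thesis unfolding of_real_eq_iff .
qed

section \<open>The resolvent on the unit disc and its Taylor coefficients\<close>

text \<open>The Kreiss condition after the substitution \<open>z = 1 / lambda\<close>. The resolvent
  bound is phrased as a lower bound for \<open>I - zT\<close>, so that it applies directly to
  vectors such as truncated Neumann series.\<close>

locale disc_resolvent =
  fixes T :: "'a::complex_hilbert_space \<Rightarrow> 'a" and C :: real
  assumes clinear: "bounded_clinear T"
    and C_pos: "C > 0"
    and bij: "cmod z < 1 \<Longrightarrow> bij (\<lambda>x. x - z *\<^sub>C T x)"
    and lower_bound: "cmod z < 1 \<Longrightarrow> norm x \<le> C / (1 - cmod z) * norm (x - z *\<^sub>C T x)"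
begin

lemma bounded_linear_T: "bounded_linear T"
  and T_scaleC: "T (c *\<^sub>C x) = c *\<^sub>C T x"
  using clinear by (auto simp: bounded_clinear_def)

lemmas T_diff = linear_diff[OF bounded_linear.linear[OF bounded_linear_T]]

lemma bounded_linear_funpow: "bounded_linear (T ^^ k)"
proof (induction k)
  case 0
  then show ?case by (simp add: id_def bounded_linear_ident)
next
  case (Suc k)
  then show ?case using bounded_linear_compose[OF bounded_linear_T] by (simp add: o_def)
qed

lemma funpow_scaleC: "(T ^^ k) (c *\<^sub>C x) = c *\<^sub>C (T ^^ k) x"
  by (induction k) (simp_all add: T_scaleC)

lemmas funpow_sum = linear_sum[OF bounded_linear.linear[OF bounded_linear_funpow]]

definition R :: "complex \<Rightarrow> 'a \<Rightarrow> 'a" where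
  "R z = inv (\<lambda>x. x - z *\<^sub>C T x)"

lemma R_right: "cmod z < 1 \<Longrightarrow> R z v - z *\<^sub>C T (R z v) = v"
  unfolding R_def using surj_f_inv_f[OF bij_is_surj[OF bij]] .

lemma R_left: "cmod z < 1 \<Longrightarrow> R z (v - z *\<^sub>C T v) = v"
  unfolding R_def using inv_f_f[OF bij_is_inj[OF bij]] .

lemma norm_R_le: "cmod z < 1 \<Longrightarrow> norm (R z v) \<le> C / (1 - cmod z) * norm v"
  using lower_bound[of z "R z v"] by (simp add: R_right)

text \<open>The resolvent identity. Applying \<open>I - wT\<close> to \<open>p\<close> and to
  \<open>R z v\<close> gives the same vector, and \<open>I - wT\<close> is injective.\<close>

lemma R_diff:
  assumes "cmod z < 1" "cmod w < 1"
  shows "R w v - R z v = (w - z) *\<^sub>C R w (T (R z v))"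
proof -
  define q where "q = R w (T (R z v))"
  have q: "q - w *\<^sub>C T q = T (R z v)" using R_right[OF assms(2)] by (simp add: q_def)
  define p where "p = R w v - (w - z) *\<^sub>C q"
  have lin: "(x - a *\<^sub>C y) - w *\<^sub>C T (x - a *\<^sub>C y) = (x - w *\<^sub>C T x) - a *\<^sub>C (y - w *\<^sub>C T y)" for a x y
    by (simp add: T_diff T_scaleC scaleC_diff_right scaleC_scaleC algebra_simps)
  have "p - w *\<^sub>C T p = (R w v - w *\<^sub>C T (R w v)) - (w - z) *\<^sub>C (q - w *\<^sub>C T q)"
    unfolding p_def by (rule lin)
  also have "\<dots> = v - (w - z) *\<^sub>C T (R z v)"
    by (simp only: q R_right[OF assms(2)])
  also have "\<dots> = R z v - w *\<^sub>C T (R z v)"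
    using R_right[OF assms(1), of v] by (simp add: scaleC_diff_left algebra_simps)
  finally have "p = R z v" using R_left[OF assms(2)] by metis
  then show ?thesis by (simp add: p_def q_def algebra_simps)
qed

lemma R_tendsto:
  assumes "cmod z < 1"
  shows "((\<lambda>w. R w v) \<longlongrightarrow> R z v) (at z)"
proof -
  have "\<forall>\<^sub>F w in at z. cmod w < 1"
    using eventually_at_in_open'[of "ball 0 1" z] assms by (auto simp: dist_norm)
  then have "\<forall>\<^sub>F w in at z. norm (R w v - R z v)
      \<le> cmod (w - z) * (C / (1 - cmod w) * norm (T (R z v)))"
  proof eventually_elim
    case (elim w)
    show ?case
      by (simp only: R_diff[OF assms elim] norm_scaleC)
        (intro mult_left_mono norm_R_le norm_ge_zero elim)
  qed
  moreover have "((\<lambda>w. cmod (w - z) * (C / (1 - cmod w) * norm (T (R z v)))) \<longlongrightarrow>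
      cmod (z - z) * (C / (1 - cmod z) * norm (T (R z v)))) (at z)"
    using assms by (intro tendsto_intros) auto
  then have "((\<lambda>w. cmod (w - z) * (C / (1 - cmod w) * norm (T (R z v)))) \<longlongrightarrow> 0) (at z)"
    by simp
  ultimately have "((\<lambda>w. R w v - R z v) \<longlongrightarrow> 0) (at z)"
    by (rule Lim_null_comparison)
  then show ?thesis by (rule LIM_zero_cancel)
qed

text \<open>Pairing with \<open>y\<close> turns the resolvent into a scalar function. By
  \<open>R_diff\<close> its difference quotient at \<open>z\<close> is the pairing of
  \<open>R w (T (R z u))\<close> with \<open>y\<close>, which converges by
  \<open>R_tendsto\<close>.\<close>

lemma holomorphic_R: "(\<lambda>z. cinner (R z u) y) holomorphic_on ball 0 1"
proof -
  have deriv: "((\<lambda>z. cinner (R z u) y) has_field_derivative cinner (R z (T (R z u))) y) (at z)"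
    if z: "cmod z < 1" for z
  proof -
    have "((\<lambda>w. cinner (R w (T (R z u))) y) \<longlongrightarrow> cinner (R z (T (R z u))) y) (at z)"
      by (rule bounded_linear.tendsto[OF bounded_linear_cinner_left R_tendsto[OF z]])
    moreover have "\<forall>\<^sub>F w in at z. cmod w < 1 \<and> w \<noteq> z"
      using eventually_at_in_open[of "ball 0 1" z] z by (auto simp: dist_norm)
    then have "\<forall>\<^sub>F w in at z. cinner (R w (T (R z u))) y
        = (cinner (R w u) y - cinner (R z u) y) / (w - z)"
      by eventually_elim
        (simp add: cinner_diff_left[symmetric] R_diff[OF z] cinner_scaleC_left)
    ultimately show ?thesis
      unfolding has_field_derivative_iff by (rule Lim_transform_eventually)
  qed
  show ?thesis
    unfolding holomorphic_on_open[OF open_ball]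
  proof
    fix z :: complex assume "z \<in> ball 0 1"
    then have "cmod z < 1" by simp
    from deriv[OF this] show "\<exists>f'. ((\<lambda>z. cinner (R z u) y) has_field_derivative f') (at z)" ..
  qed
qed

text \<open>These are the Taylor coefficients of the Neumann series. Since
  \<open>R z u = u + z R z (T u)\<close>, the coefficient of order \<open>k + 1\<close> for
  \<open>u\<close> is that of order \<open>k\<close> for \<open>T u\<close>.\<close>

lemma higher_deriv_R: "(deriv ^^ k) (\<lambda>z. cinner (R z u) y) 0 = fact k * cinner ((T ^^ k) u) y"
proof (induction k arbitrary: u)
  case 0
  show ?case using R_right[of 0 u] by simp
next
  case (Suc k)
  let ?g = "\<lambda>z. cinner (R z (T u)) y"
  have eq: "cinner (R z u) y = cinner u y + z * ?g z" if "z \<in> ball 0 1" for z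
  proof -
    have z: "cmod z < 1" using that by simp
    have "R z u - R 0 u = z *\<^sub>C R z (T (R 0 u))" using R_diff[of 0 z u] z by simp
    moreover have "R 0 u = u" using R_right[of 0 u] by simp
    ultimately have "R z u = u + z *\<^sub>C R z (T u)" by (simp add: algebra_simps)
    then show ?thesis by (simp add: cinner_add_left cinner_scaleC_left)
  qed
  have g: "?g holomorphic_on ball 0 1" by (rule holomorphic_R)
  have "(deriv ^^ Suc k) (\<lambda>z. cinner (R z u) y) 0 = (deriv ^^ Suc k) (\<lambda>z. cinner u y + z * ?g z) 0"
    using eq by (intro higher_deriv_transform_within_open[of _ "ball 0 1"] holomorphic_R
        holomorphic_intros g) auto
  also have "\<dots> = (deriv ^^ Suc k) (\<lambda>z. cinner u y) 0 + (deriv ^^ Suc k) (\<lambda>z. z * ?g z) 0"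
    by (rule higher_deriv_add[of _ "ball 0 1"]) (auto intro!: holomorphic_intros g)
  also have "\<dots> = (\<Sum>i = 0..Suc k. of_nat (Suc k choose i) * (deriv ^^ i) (\<lambda>z. z) 0
      * (deriv ^^ (Suc k - i)) ?g 0)"
    by (subst higher_deriv_mult[of _ "ball 0 1"])
      (auto intro!: holomorphic_intros g simp: higher_deriv_const simp del: funpow.simps)
  \<comment> \<open>In Leibniz's rule only \<open>i = 1\<close> survives, because at 0 all other
    derivatives of the identity vanish; it contributes the factor \<open>Suc k\<close>.\<close>
  also have "\<dots> = (\<Sum>i\<in>{1}. of_nat (Suc k choose i) * (deriv ^^ i) (\<lambda>z. z) 0
      * (deriv ^^ (Suc k - i)) ?g 0)"
    by (rule sum.mono_neutral_right) (auto simp: higher_deriv_ident simp del: funpow.simps)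
  also have "\<dots> = fact (Suc k) * cinner ((T ^^ Suc k) u) y"
    by (simp add: Suc.IH funpow_swap1)
  finally show ?case .
qed

section \<open>Growth of powers and truncated Neumann series\<close>

text \<open>Cauchy's inequality on the circle of radius \<open>r\<close>, tested against
  \<open>y = (T ^^ k) u\<close>: the coefficient is then \<open>fact k\<close> times the square of
  \<open>norm y\<close>, and one factor \<open>norm y\<close> cancels.\<close>

lemma power_growth:
  assumes "0 < r" "r < 1"
  shows "r ^ k * norm ((T ^^ k) u) \<le> C / (1 - r) * norm u"
proof (cases "(T ^^ k) u = 0")
  case True
  then show ?thesis using assms C_pos by simp
next
  case False
  define y where "y = (T ^^ k) u"
  let ?f = "\<lambda>z. cinner (R z u) y"
  have "cmod ((deriv ^^ k) ?f 0) \<le> fact k * (C / (1 - r) * norm u * norm y) / r ^ k"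
  proof (rule Cauchy_inequality)
    show "?f holomorphic_on ball 0 r"
      using holomorphic_R by (rule holomorphic_on_subset) (use assms in auto)
    show "continuous_on (cball 0 r) ?f"
      using holomorphic_on_imp_continuous_on[OF holomorphic_R]
      by (rule continuous_on_subset) (use assms in auto)
    show "cmod (?f z) \<le> C / (1 - r) * norm u * norm y" if "cmod (0 - z) = r" for z
    proof -
      have "cmod (?f z) \<le> norm (R z u) * norm y" by (rule norm_cinner_le)
      also have "\<dots> \<le> C / (1 - r) * norm u * norm y"
        using norm_R_le[of z u] that assms by (intro mult_right_mono) auto
      finally show ?thesis .
    qed
  qed (use assms in auto)
  also have "(deriv ^^ k) ?f 0 = fact k * complex_of_real ((norm y)\<^sup>2)"
    by (simp add: higher_deriv_R cinner_self y_def)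
  finally have "fact k * (norm y)\<^sup>2 \<le> fact k * (C / (1 - r) * norm u * norm y / r ^ k)"
    by (simp add: norm_mult norm_power)
  then have "(norm y)\<^sup>2 \<le> C / (1 - r) * norm u * norm y / r ^ k"
    by (simp only: mult_le_cancel_left_pos[OF fact_gt_zero])
  then have "norm y * norm y \<le> (C / (1 - r) * norm u / r ^ k) * norm y"
    by (simp add: power2_eq_square)
  then have "norm y \<le> C / (1 - r) * norm u / r ^ k"
    using False by (simp only: y_def mult_le_cancel_right) auto
  then have "norm y * r ^ k \<le> C / (1 - r) * norm u"
    using assms by (simp only: pos_le_divide_eq zero_less_power)
  then show ?thesis by (simp only: y_def mult.commute)
qed

text \<open>\<open>power_growth\<close> at a radius \<open>s\<close> strictly between
  \<open>r\<close> and 1 leaves the factor \<open>(r / s) ^ m\<close>, which tends to 0 and absorbs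
  the constant.\<close>

lemma power_contractive:
  assumes "0 < r" "r < 1"
  obtains m where "m \<ge> N" "\<And>u. r ^ m * norm ((T ^^ m) u) \<le> norm u"
proof -
  define s where "s = (1 + r) / 2"
  have s: "0 < s" "s < 1" "r < s" using assms by (auto simp: s_def)
  have "(\<lambda>m. C / (1 - s) * (r / s) ^ m) \<longlonglongrightarrow> C / (1 - s) * 0"
    using s assms by (intro tendsto_intros LIMSEQ_power_zero) auto
  then have "\<forall>\<^sub>F m in sequentially. C / (1 - s) * (r / s) ^ m < 1"
    by (intro order_tendstoD) auto
  then obtain m where m: "m \<ge> N" "C / (1 - s) * (r / s) ^ m < 1"
    unfolding eventually_sequentially by (meson nle_le)
  have "r ^ m * norm ((T ^^ m) u) \<le> norm u" for u
  proof -
    have "r ^ m * norm ((T ^^ m) u) = (r / s) ^ m * (s ^ m * norm ((T ^^ m) u))"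
      using s by (simp add: power_divide)
    also have "\<dots> \<le> (r / s) ^ m * (C / (1 - s) * norm u)"
      using s assms by (intro mult_left_mono power_growth) auto
    also have "\<dots> = (C / (1 - s) * (r / s) ^ m) * norm u" by simp
    also have "\<dots> \<le> 1 * norm u" using m by (intro mult_right_mono) auto
    finally show ?thesis by simp
  qed
  with m that show ?thesis by blast
qed

text \<open>The truncated series obeys the resolvent bound up to a factor 2: applying
  \<open>I - zT\<close> telescopes it to \<open>u\<close> minus a remainder whose norm is at most
  that of \<open>u\<close>.\<close>

lemma partial_sum_bound:
  assumes r: "0 < r" "r < 1" and m: "\<And>u. r ^ m * norm ((T ^^ m) u) \<le> norm u" and z: "cmod z = r"
  shows "norm (\<Sum>k<m. z ^ k *\<^sub>C (T ^^ k) u) \<le> 2 * C / (1 - r) * norm u"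
proof -
  define s where "s n = (\<Sum>k<n. z ^ k *\<^sub>C (T ^^ k) u)" for n
  have tel: "s n - z *\<^sub>C T (s n) = u - z ^ n *\<^sub>C (T ^^ n) u" for n
  proof (induction n)
    case 0
    show ?case using linear_0[OF bounded_linear.linear[OF bounded_linear_T]]
      by (simp add: s_def scaleC_one)
  next
    case (Suc n)
    have "s (Suc n) = s n + z ^ n *\<^sub>C (T ^^ n) u" by (simp add: s_def)
    then have "s (Suc n) - z *\<^sub>C T (s (Suc n))
        = (s n - z *\<^sub>C T (s n)) + z ^ n *\<^sub>C (T ^^ n) u - z ^ Suc n *\<^sub>C (T ^^ Suc n) u"
      by (simp add: linear_add[OF bounded_linear.linear[OF bounded_linear_T]] T_scaleC
          scaleC_add_right scaleC_scaleC algebra_simps)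
    then show ?case by (simp add: Suc.IH)
  qed
  have "norm (s m) \<le> C / (1 - r) * norm (u - z ^ m *\<^sub>C (T ^^ m) u)"
    using lower_bound[of z "s m"] r z by (simp add: tel)
  also have "\<dots> \<le> C / (1 - r) * (norm u + norm u)"
  proof (intro mult_left_mono)
    show "norm (u - z ^ m *\<^sub>C (T ^^ m) u) \<le> norm u + norm u"
      using norm_triangle_ineq4[of u "z ^ m *\<^sub>C (T ^^ m) u"] m[of u] z
      by (simp add: norm_scaleC norm_power)
  qed (use r C_pos in auto)
  also have "\<dots> = 2 * C / (1 - r) * norm u" by simp
  finally show ?thesis by (simp only: s_def)
qed

section \<open>Square function bounds\<close>

text \<open>This radius balances two demands: \<open>1 / (1 - r)\<close> is only
  \<open>n + 1\<close>, while the weights \<open>r ^ j\<close> with \<open>j <= n\<close> stay above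
  1/3, since \<open>(1 + 1/n) ^ n <= exp 1 <= 3\<close>.\<close>

lemma block_radius:
  assumes n: "n \<ge> (1::nat)"
  defines "r \<equiv> real n / real (Suc n)"
  shows "0 < r" "r < 1" "2 * C / (1 - r) \<le> 4 * C * real n" "j \<le> n \<Longrightarrow> 1 \<le> 3 * r ^ j"
proof -
  show r: "0 < r" "r < 1" using n by (auto simp: r_def)
  have "1 / (1 - r) = real n + 1" by (simp add: r_def field_simps)
  then have "2 * C / (1 - r) = 2 * C * (real n + 1)" by (metis times_divide_eq_right mult.right_neutral)
  also have "\<dots> \<le> 2 * C * (2 * real n)" using n C_pos by (intro mult_left_mono) auto
  finally show "2 * C / (1 - r) \<le> 4 * C * real n" by simp
  assume j: "j \<le> n"
  have "(1 / r) ^ n = (1 + 1 / real n) ^ n"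
    using n by (simp add: r_def field_simps)
  also have "\<dots> \<le> exp (1 / real n) ^ n"
    by (intro power_mono exp_ge_add_one_self) auto
  also have "\<dots> = exp 1" using n by (simp only: exp_of_nat_mult[symmetric]) simp
  also have "\<dots> \<le> 3" by (rule exp_le)
  finally have "1 \<le> 3 * r ^ n" using r by (simp add: power_divide divide_simps)
  also have "\<dots> \<le> 3 * r ^ j" using j r by (intro mult_left_mono power_decreasing) auto
  finally show "1 \<le> 3 * r ^ j" .
qed

text \<open>Insert the weights \<open>r ^ k\<close> at the cost of a factor 3, enlarge the sum to
  length \<open>m\<close>, and apply Parseval: each of the \<open>m\<close> transforms is a
  truncated Neumann series on the circle of radius \<open>r\<close>. The constant 12 is 3 times
  4.\<close>

lemma orbit_square_sum:
  assumes n: "n \<ge> 1"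
  shows "(\<Sum>k<n. (norm ((T ^^ k) x))\<^sup>2) \<le> (12 * C * real n * norm x)\<^sup>2"
proof -
  define r where "r = real n / real (Suc n)"
  note r = block_radius[OF n, folded r_def]
  obtain m where m: "m \<ge> n" "\<And>u. r ^ m * norm ((T ^^ m) u) \<le> norm u"
    using power_contractive[OF r(1,2)] by blast
  define v where "v k = complex_of_real r ^ k *\<^sub>C (T ^^ k) x" for k
  have "(\<Sum>k<n. (norm ((T ^^ k) x))\<^sup>2) \<le> (\<Sum>k<n. 9 * (norm (v k))\<^sup>2)"
  proof (rule sum_mono)
    fix k assume "k \<in> {..<n}"
    then have "1 * norm ((T ^^ k) x) \<le> 3 * r ^ k * norm ((T ^^ k) x)"
      by (intro mult_right_mono r) auto
    then have "norm ((T ^^ k) x) \<le> 3 * norm (v k)"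
      using r by (simp add: v_def norm_scaleC norm_power)
    then have "(norm ((T ^^ k) x))\<^sup>2 \<le> (3 * norm (v k))\<^sup>2" by (rule power_mono) simp
    then show "(norm ((T ^^ k) x))\<^sup>2 \<le> 9 * (norm (v k))\<^sup>2" by (simp add: power_mult_distrib)
  qed
  also have "\<dots> \<le> (\<Sum>k<m. 9 * (norm (v k))\<^sup>2)" using m by (intro sum_mono2) auto
  finally have 1: "(\<Sum>k<n. (norm ((T ^^ k) x))\<^sup>2) \<le> 9 * (\<Sum>k<m. (norm (v k))\<^sup>2)"
    by (simp add: sum_distrib_left)
  have "real m * (\<Sum>k<m. (norm (v k))\<^sup>2)
      = (\<Sum>l<m. (norm (\<Sum>k<m. unity_root m l ^ k *\<^sub>C v k))\<^sup>2)"
    by (rule unity_root_Parseval[symmetric])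
  also have "\<dots> \<le> (\<Sum>l<m. (4 * C * real n * norm x)\<^sup>2)"
  proof (intro sum_mono power_mono)
    fix l
    have "(\<Sum>k<m. unity_root m l ^ k *\<^sub>C v k)
        = (\<Sum>k<m. (unity_root m l * complex_of_real r) ^ k *\<^sub>C (T ^^ k) x)"
      by (simp add: v_def scaleC_scaleC power_mult_distrib)
    then have "norm (\<Sum>k<m. unity_root m l ^ k *\<^sub>C v k) \<le> 2 * C / (1 - r) * norm x"
      using partial_sum_bound[OF r(1,2) m(2)] r by (simp add: norm_mult)
    also have "\<dots> \<le> 4 * C * real n * norm x" by (intro mult_right_mono r) simp
    finally show "norm (\<Sum>k<m. unity_root m l ^ k *\<^sub>C v k) \<le> 4 * C * real n * norm x" .
  qed simp
  finally have "real m * (\<Sum>k<m. (norm (v k))\<^sup>2) \<le> real m * (4 * C * real n * norm x)\<^sup>2" by simp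
  then have "(\<Sum>k<m. (norm (v k))\<^sup>2) \<le> (4 * C * real n * norm x)\<^sup>2"
    using m n by (simp only: mult_le_cancel_left)
  with 1 have "(\<Sum>k<n. (norm ((T ^^ k) x))\<^sup>2) \<le> 9 * (4 * C * real n * norm x)\<^sup>2" by linarith
  also have "\<dots> = (12 * C * real n * norm x)\<^sup>2" by (simp add: power_mult_distrib)
  finally show ?thesis .
qed

text \<open>This is the dual form of \<open>orbit_square_sum\<close>; proving it directly avoids the adjoint of \<^term>\<open>T\<close>.\<close>

lemma dual_orbit_square_sum:
  assumes n: "n \<ge> 1"
  shows "(norm (\<Sum>j<n. (T ^^ j) (z j)))\<^sup>2 \<le> (12 * C * real n)\<^sup>2 * (\<Sum>j<n. (norm (z j))\<^sup>2)"
proof -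
  define r where "r = real n / real (Suc n)"
  note r = block_radius[OF n, folded r_def]
  obtain m where m: "m \<ge> n" "\<And>u. r ^ m * norm ((T ^^ m) u) \<le> norm u"
    using power_contractive[OF r(1,2)] by blast
  let ?w = "unity_root m" and ?r = "complex_of_real r"
  \<comment> \<open>Dividing by \<open>r ^ j\<close> cancels the weight of the Neumann series later
    on, and padding with zeros makes the length match the \<open>m\<close>-th roots of
    unity.\<close>
  define v where "v j = (if j < n then (1 / ?r ^ j) *\<^sub>C z j else 0)" for j
  define Z where "Z l = (\<Sum>j<m. ?w l ^ j *\<^sub>C v j)" for l
  define S where "S = (\<Sum>j<n. (T ^^ j) (z j))"
  have v: "(norm (v j))\<^sup>2 \<le> 9 * (norm (z j))\<^sup>2" if "j < n" for j
  proof -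
    have "1 * norm (z j) \<le> 3 * r ^ j * norm (z j)"
      using that by (intro mult_right_mono r) auto
    then have "norm (v j) \<le> 3 * norm (z j)"
      using that r by (simp add: v_def norm_scaleC norm_divide norm_power field_simps)
    then have "(norm (v j))\<^sup>2 \<le> (3 * norm (z j))\<^sup>2" by (rule power_mono) simp
    then show ?thesis by (simp add: power_mult_distrib)
  qed
  \<comment> \<open>Applying the truncated series at the conjugate points
    \<open>cnj (?w l) * ?r\<close> to the discrete Fourier transform \<open>Z\<close> of
    \<open>v\<close> and summing over \<open>l\<close> pairs \<open>T ^^ k\<close> with
    \<open>v k\<close> alone, by orthogonality; the result is \<open>m\<close> times
    \<open>S\<close>.\<close>
  have "(\<Sum>l<m. \<Sum>k<m. (cnj (?w l) * ?r) ^ k *\<^sub>C (T ^^ k) (Z l))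
      = (\<Sum>l<m. \<Sum>k<m. \<Sum>j<m. (?w l ^ j * cnj (?w l ^ k)) *\<^sub>C ?r ^ k *\<^sub>C (T ^^ k) (v j))"
    by (simp add: Z_def funpow_sum funpow_scaleC scaleC_sum_right scaleC_scaleC power_mult_distrib
        mult_ac)
  also have "\<dots> = (\<Sum>k<m. \<Sum>j<m. \<Sum>l<m. (?w l ^ j * cnj (?w l ^ k)) *\<^sub>C ?r ^ k *\<^sub>C (T ^^ k) (v j))"
    by (subst sum.swap, rule sum.cong[OF refl], rule sum.swap)
  also have "\<dots> = (\<Sum>k<m. \<Sum>j<m. (if j = k then of_nat m else 0) *\<^sub>C ?r ^ k *\<^sub>C (T ^^ k) (v j))"
    by (simp only: scaleC_sum_left[symmetric])
      (intro sum.cong refl arg_cong2[where f = scaleC] sum_unity_root, auto)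
  also have "\<dots> = (\<Sum>k<m. of_nat m *\<^sub>C ?r ^ k *\<^sub>C (T ^^ k) (v k))"
    by (intro sum.cong refl) (simp add: if_distrib[of "\<lambda>c. c *\<^sub>C _"] cong: if_cong)
  also have "\<dots> = of_nat m *\<^sub>C (\<Sum>k<m. ?r ^ k *\<^sub>C (T ^^ k) (v k))"
    by (simp add: scaleC_sum_right)
  also have "(\<Sum>k<m. ?r ^ k *\<^sub>C (T ^^ k) (v k)) = (\<Sum>k<n. ?r ^ k *\<^sub>C (T ^^ k) (v k))"
    using m linear_0[OF bounded_linear.linear[OF bounded_linear_funpow]]
    by (intro sum.mono_neutral_right) (auto simp: v_def)
  also have "\<dots> = S"
    unfolding S_def using r
    by (intro sum.cong refl) (simp add: v_def funpow_scaleC scaleC_scaleC scaleC_one)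
  finally have "real m * norm S
      = norm (\<Sum>l<m. \<Sum>k<m. (cnj (?w l) * ?r) ^ k *\<^sub>C (T ^^ k) (Z l))"
    by (simp add: norm_scaleC)
  also have "\<dots> \<le> (\<Sum>l<m. 4 * C * real n * norm (Z l))"
  proof (rule sum_norm_le)
    fix l
    have "norm (\<Sum>k<m. (cnj (?w l) * ?r) ^ k *\<^sub>C (T ^^ k) (Z l)) \<le> 2 * C / (1 - r) * norm (Z l)"
      using partial_sum_bound[OF r(1,2) m(2)] r by (simp add: norm_mult)
    also have "\<dots> \<le> 4 * C * real n * norm (Z l)" by (intro mult_right_mono r) simp
    finally show "norm (\<Sum>k<m. (cnj (?w l) * ?r) ^ k *\<^sub>C (T ^^ k) (Z l))
        \<le> 4 * C * real n * norm (Z l)" .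
  qed
  finally have "(real m * norm S)\<^sup>2 \<le> (4 * C * real n * (\<Sum>l<m. norm (Z l)))\<^sup>2"
    by (intro power_mono) (simp_all add: sum_distrib_left)
  \<comment> \<open>Cauchy-Schwarz over \<open>l\<close> costs one factor \<open>m\<close> and
    Parseval below yields another, so the square of \<open>m\<close> cancels.\<close>
  also have "\<dots> \<le> (4 * C * real n)\<^sup>2 * (real m * (\<Sum>l<m. (norm (Z l))\<^sup>2))"
    using sum_squared_le_sum_of_squares[of "\<lambda>l. norm (Z l)" "{..<m}"]
    by (simp only: power_mult_distrib[of _ "sum _ _"]) (intro mult_left_mono, auto simp: mult.commute)
  also have "(\<Sum>l<m. (norm (Z l))\<^sup>2) = real m * (\<Sum>j<m. (norm (v j))\<^sup>2)"
    unfolding Z_def by (rule unity_root_Parseval)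
  also have "(\<Sum>j<m. (norm (v j))\<^sup>2) = (\<Sum>j<n. (norm (v j))\<^sup>2)"
    using m by (intro sum.mono_neutral_right) (auto simp: v_def)
  finally have "(real m)\<^sup>2 * (norm S)\<^sup>2
      \<le> (real m)\<^sup>2 * ((4 * C * real n)\<^sup>2 * (\<Sum>j<n. (norm (v j))\<^sup>2))"
    by (simp add: power_mult_distrib power2_eq_square mult_ac)
  then have "(norm S)\<^sup>2 \<le> (4 * C * real n)\<^sup>2 * (\<Sum>j<n. (norm (v j))\<^sup>2)"
    using m n by (simp only: mult_le_cancel_left) auto
  also have "\<dots> \<le> (4 * C * real n)\<^sup>2 * (\<Sum>j<n. 9 * (norm (z j))\<^sup>2)"
    by (intro mult_left_mono sum_mono v) auto
  finally show ?thesis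
    by (simp add: S_def power_mult_distrib sum_distrib_left[symmetric])
qed

section \<open>Dyadic blocks and the logarithmic gain\<close>

text \<open>For every \<open>j\<close> in the block, \<open>T ^^ j\<close> maps \<open>z j\<close>
  to \<open>(T ^^ N) x\<close>, so the dual sum is \<open>2 ^ i\<close> copies of one vector. The
  dual bound has length \<open>2 ^ Suc i\<close>; after cancelling the square of
  \<open>2 ^ i\<close> a factor 4 remains.\<close>

lemma dyadic_block:
  assumes "2 ^ Suc i \<le> N"
  shows "(norm ((T ^^ N) x))\<^sup>2
    \<le> 4 * (12 * C)\<^sup>2 * (\<Sum>j\<in>{2 ^ i..<2 ^ Suc i}. (norm ((T ^^ (N - j)) x))\<^sup>2)"
proof -
  let ?B = "{2 ^ i..<2 ^ Suc i} :: nat set"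
  define z where "z j = (if j \<in> ?B then (T ^^ (N - j)) x else 0)" for j
  have restrict: "(\<Sum>j<2 ^ Suc i. f j) = (\<Sum>j\<in>?B. f j)" if "\<And>j. j \<notin> ?B \<Longrightarrow> f j = 0"
    for f :: "nat \<Rightarrow> 'b::comm_monoid_add"
    using that by (intro sum.mono_neutral_right) auto
  have "(\<Sum>j<2 ^ Suc i. (T ^^ j) (z j)) = (\<Sum>j\<in>?B. (T ^^ j) (z j))"
    using linear_0[OF bounded_linear.linear[OF bounded_linear_funpow]]
    by (intro restrict) (auto simp: z_def)
  also have "\<dots> = (\<Sum>j\<in>?B. (T ^^ N) x)"
    using assms by (intro sum.cong refl) (auto simp: z_def funpow_add[symmetric, THEN fun_cong, unfolded o_apply])
  also have "\<dots> = (2 ^ i) *\<^sub>R (T ^^ N) x" by (simp add: sum_constant_scaleR)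
  finally have "(2 ^ i * norm ((T ^^ N) x))\<^sup>2 = (norm (\<Sum>j<2 ^ Suc i. (T ^^ j) (z j)))\<^sup>2" by simp
  also have "\<dots> \<le> (12 * C * real (2 ^ Suc i))\<^sup>2 * (\<Sum>j<2 ^ Suc i. (norm (z j))\<^sup>2)"
    by (rule dual_orbit_square_sum) simp
  also have "(\<Sum>j<2 ^ Suc i. (norm (z j))\<^sup>2) = (\<Sum>j\<in>?B. (norm (z j))\<^sup>2)"
    by (rule restrict) (auto simp: z_def)
  also have "\<dots> = (\<Sum>j\<in>?B. (norm ((T ^^ (N - j)) x))\<^sup>2)"
    by (intro sum.cong) (auto simp: z_def)
  finally have "(2 ^ i)\<^sup>2 * (norm ((T ^^ N) x))\<^sup>2
      \<le> (2 ^ i)\<^sup>2 * (4 * (12 * C)\<^sup>2 * (\<Sum>j\<in>?B. (norm ((T ^^ (N - j)) x))\<^sup>2))"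
    by (simp add: power_mult_distrib mult_ac)
  then show ?thesis by (simp only: mult_le_cancel_left) auto
qed

lemma norm_funpow_le:
  assumes N: "N \<ge> 2"
  shows "norm ((T ^^ N) x) \<le> 4 * (12 * C)\<^sup>2 * (real N / sqrt (ln (real N))) * norm x"
proof -
  \<comment> \<open>\<open>L\<close> is the number of complete dyadic blocks below
    \<open>2 ^ L <= N\<close>.\<close>
  define L where "L = floor_log N"
  have L1: "2 ^ L \<le> N" and L2: "N < 2 ^ Suc L"
    using N by (simp_all add: L_def floor_log_exp2_le floor_log_exp2_gt)
  define a where "a j = (norm ((T ^^ (N - j)) x))\<^sup>2" for j
  define M where "M = norm ((T ^^ N) x)"
  \<comment> \<open>The blocks with index below \<open>l\<close> partition
    \<open>{1..<2 ^ l}\<close>, and each one contributes its own copy of \<open>M\<close>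
    squared.\<close>
  have "real l * M\<^sup>2 \<le> 4 * (12 * C)\<^sup>2 * (\<Sum>j\<in>{1..<2 ^ l}. a j)" if "2 ^ l \<le> N" for l
    using that
  proof (induction l)
    case (Suc l)
    have "real l * M\<^sup>2 \<le> 4 * (12 * C)\<^sup>2 * (\<Sum>j\<in>{1..<2 ^ l}. a j)"
      using Suc by simp
    moreover have "M\<^sup>2 \<le> 4 * (12 * C)\<^sup>2 * (\<Sum>j\<in>{2 ^ l..<2 ^ Suc l}. a j)"
      unfolding M_def a_def by (rule dyadic_block[OF Suc.prems])
    moreover have "(\<Sum>j\<in>{1..<2 ^ Suc l}. a j) = (\<Sum>j\<in>{1..<2 ^ l}. a j) + (\<Sum>j\<in>{2 ^ l..<2 ^ Suc l}. a j)"
      by (rule sum.atLeastLessThan_concat[symmetric]) auto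
    ultimately show ?case by (simp add: algebra_simps)
  qed simp
  then have LM': "real L * M\<^sup>2 \<le> 4 * (12 * C)\<^sup>2 * (\<Sum>j\<in>{1..<2 ^ L}. a j)" using L1 by blast
  have "(\<Sum>j\<in>{1..<2 ^ L}. a j) \<le> (\<Sum>j\<in>{1..N}. a j)"
    using L1 by (intro sum_mono2) (auto simp: a_def)
  also have "(\<Sum>j\<in>{1..N}. a j) = (\<Sum>k<N. (norm ((T ^^ k) x))\<^sup>2)"
    by (rule sum.reindex_bij_witness[of _ "\<lambda>k. N - k" "\<lambda>j. N - j"]) (auto simp: a_def)
  also have "\<dots> \<le> (12 * C * real N * norm x)\<^sup>2" using N by (intro orbit_square_sum) simp
  finally have LM: "real L * M\<^sup>2 \<le> 4 * (12 * C)\<^sup>2 * (12 * C * real N * norm x)\<^sup>2"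
    by (intro order_trans[OF LM'] mult_left_mono) auto
  have lnN: "ln (real N) > 0" using N by simp
  have "L \<ge> 1" using L2 N by (cases L) auto
  \<comment> \<open>Converts the block count into a logarithm:
    \<open>ln N <= (L + 1) ln 2 <= 2 L\<close>, where the last inequality needs
    \<open>L >= 1\<close>.\<close>
  have "ln (real N) \<le> ln (2 ^ Suc L)"
  proof (subst ln_le_cancel_iff)
    have "real N \<le> real (2 ^ Suc L)" using L2 by (simp only: of_nat_le_iff)
    then show "real N \<le> 2 ^ Suc L" by simp
  qed (use N in auto)
  also have "\<dots> = real (Suc L) * ln 2" by (subst ln_realpow) auto
  also have "\<dots> \<le> real (Suc L) * 1" using ln_2_less_1 by (intro mult_left_mono) auto
  also have "\<dots> \<le> 2 * real L" using \<open>L \<ge> 1\<close> by simp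
  finally have "ln (real N) * M\<^sup>2 \<le> 2 * real L * M\<^sup>2" by (intro mult_right_mono) auto
  \<comment> \<open>The constant 8 obtained from \<open>LM\<close> is relaxed to the perfect square
    16, so that the final square root has the constant 4.\<close>
  also have "\<dots> \<le> 16 * (12 * C)\<^sup>2 * (12 * C * real N * norm x)\<^sup>2"
  proof -
    have "0 \<le> (12 * C)\<^sup>2 * (12 * C * real N * norm x)\<^sup>2" by simp
    with LM show ?thesis by linarith
  qed
  finally have "M\<^sup>2 \<le> 16 * (12 * C)\<^sup>2 * (12 * C * real N * norm x)\<^sup>2 / ln (real N)"
    using lnN by (simp only: pos_le_divide_eq mult.commute)
  also have "\<dots> = 16 * (12 * C)\<^sup>2 * (12 * C * real N * norm x)\<^sup>2 / (sqrt (ln (real N)))\<^sup>2"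
    using lnN by simp
  also have "\<dots> = (4 * (12 * C)\<^sup>2 * (real N / sqrt (ln (real N))) * norm x)\<^sup>2"
    unfolding power2_eq_square by simp
  finally have "M\<^sup>2 \<le> (4 * (12 * C)\<^sup>2 * (real N / sqrt (ln (real N))) * norm x)\<^sup>2" .
  then show ?thesis
    unfolding M_def by (rule power2_le_imp_le) (use lnN in simp)
qed

end

section \<open>From Kreiss boundedness to the disc, and the conclusion\<close>

text \<open>For nonzero \<open>z\<close>, \<open>I - zT\<close> is \<open>z\<close> times
  \<open>(1/z) I - T\<close>, and the factor \<open>z\<close> turns
  \<open>C / (1 / cmod z - 1)\<close> into \<open>C / (1 - cmod z)\<close>. The point
  \<open>z = 0\<close> corresponds to infinity and is treated separately; there the bound asks for a
  constant at least 1, hence \<open>max 1 C\<close>.\<close>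

lemma kreiss_bounded_imp_disc_resolvent:
  assumes "kreiss_bounded T"
  obtains C where "disc_resolvent T C"
proof -
  from assms obtain C where T: "bounded_clinear T" and C: "C > 0"
    and res: "\<And>z. cmod z > 1 \<Longrightarrow> bij (\<lambda>x. z *\<^sub>C x - T x) \<and>
      bounded_clinear (inv (\<lambda>x. z *\<^sub>C x - T x)) \<and>
      onorm (inv (\<lambda>x. z *\<^sub>C x - T x)) \<le> C / (cmod z - 1)"
    unfolding kreiss_bounded_def Let_def by blast
  have "bij (\<lambda>x. x - z *\<^sub>C T x) \<and>
      (\<forall>x. norm x \<le> max 1 C / (1 - cmod z) * norm (x - z *\<^sub>C T x))" if z: "cmod z < 1" for z
  proof (cases "z = 0")
    case True
    have "norm x \<le> max 1 C * norm x" for x :: 'a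
      using mult_right_mono[of 1 "max 1 C" "norm x"] by simp
    then show ?thesis using True by (simp add: bij_id[unfolded id_def])
  next
    case False
    define S where "S = (\<lambda>x. (1 / z) *\<^sub>C x - T x)"
    have z1: "cmod (1 / z) > 1" using z False by (simp add: norm_divide divide_simps)
    have S: "bij S" "bounded_linear (inv S)" "onorm (inv S) \<le> C / (cmod (1 / z) - 1)"
      using res[OF z1] by (auto simp: S_def bounded_clinear_def)
    have eq: "x - z *\<^sub>C T x = z *\<^sub>C S x" for x
      using False by (simp add: S_def scaleC_diff_right scaleC_scaleC scaleC_one)
    have "bij (\<lambda>x::'a. z *\<^sub>C x)"
      by (rule o_bij[where g = "\<lambda>x. (1 / z) *\<^sub>C x"])
        (use False in \<open>auto simp: fun_eq_iff scaleC_scaleC scaleC_one\<close>)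
    then have "bij (\<lambda>x. x - z *\<^sub>C T x)"
      using bij_comp[OF S(1)] by (simp add: eq o_def)
    moreover have "norm x \<le> max 1 C / (1 - cmod z) * norm (x - z *\<^sub>C T x)" for x
    proof -
      have "norm x = norm (inv S (S x))" using S(1) by (simp add: bij_is_inj)
      also have "\<dots> \<le> onorm (inv S) * norm (S x)" by (rule onorm[OF S(2)])
      also have "\<dots> \<le> C / (cmod (1 / z) - 1) * norm (S x)" by (intro mult_right_mono S) simp
      also have "\<dots> = C / (1 - cmod z) * norm (x - z *\<^sub>C T x)"
        using z False by (simp add: eq norm_scaleC norm_divide field_simps)
      also have "\<dots> \<le> max 1 C / (1 - cmod z) * norm (x - z *\<^sub>C T x)"
        using z by (intro mult_right_mono divide_right_mono) auto
      finally show ?thesis .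
    qed
    ultimately show ?thesis by blast
  qed
  then have "disc_resolvent T (max 1 C)"
    using T by unfold_locales auto
  then show ?thesis by (rule that)
qed

theorem theorem2p4:
  fixes T :: "'a::complex_hilbert_space \<Rightarrow> 'a"
  assumes "kreiss_bounded T"
  shows "(\<lambda>n::nat. onorm (T ^^ n)) \<in> O(\<lambda>n. real n / sqrt (ln (real n)))"
proof -
  obtain C where "disc_resolvent T C"
    using kreiss_bounded_imp_disc_resolvent[OF assms] .
  then interpret disc_resolvent T C .
  have "\<forall>\<^sub>F n in sequentially. norm (onorm (T ^^ n))
      \<le> 4 * (12 * C)\<^sup>2 * norm (real n / sqrt (ln (real n)))"
    using eventually_ge_at_top[of 2]
  proof eventually_elim
    case (elim n)
    then have "onorm (T ^^ n) \<le> 4 * (12 * C)\<^sup>2 * (real n / sqrt (ln (real n)))"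
      by (intro onorm_bound norm_funpow_le) auto
    moreover have "0 \<le> onorm (T ^^ n)" by (rule onorm_pos_le[OF bounded_linear_funpow])
    moreover have "0 \<le> real n / sqrt (ln (real n))" using elim by simp
    ultimately show ?case by (simp only: real_norm_def abs_of_nonneg)
  qed
  then show ?thesis by (rule bigoI)
qed

end
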